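(* Let $n\ge3$ and let $\mathcal P_\ell$ be a homogeneous polynomial of degree $\ell$ on $\mathbb R^n$; let $h_\ell$ be the largest integer $\le\ell/2$. Assume that (i) when $n$ is even: $2\le\ell<n+2$ and $\Delta_o^{(h_\ell)}\mathcal P_\ell\equiv0$; (ii) when $n$ is odd: $\ell\ge2$ and $\Delta_o^{(h_\ell)}\mathcal P_\ell\equiv0$. Then the equation $$(1+\mathcal R^2)\,\Delta_o\Gamma-2n\,[\mathcal Y\cdot\nabla\Gamma]+2n\,\Gamma=\mathcal P_\ell\quad\text{in }\mathbb R^n,\qquad \mathcal R=|\mathcal Y|,$$ has the polynomial solution $$\mathcal G_o=\sum_{0\le j\le k\le h_\ell-1}C^j_k\,(\mathcal R^2)^j\,[\Delta_o^{(k)}\mathcal P_\ell],$$ with the coefficients $C^j_k$ given in the context. In particular, $\mathcal G_o$ has no constant term and no linear terms, and the degree of each term in $\mathcal G_o$ is at most $\ell$.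
   Context: $\Delta_o$ is the Euclidean Laplacian on $\mathbb R^n$, $\Delta_o^{(k)}$ its $k$-th iterate ($\Delta_o^{(0)}$ the identity). Put $A_{\ell,j,k}=(2j)(2j+n-2+2\ell-4k)$. The coefficients are defined recursively by: $C^0_0=-\frac{1}{2n(\ell-1)}$; $C^j_j=-\frac{C^{j-1}_{j-1}}{A_{\ell,j,j}-2n(\ell-1)}$ for $1\le j\le h_\ell-1$; $C^0_k=-\frac{C^0_{k-1}+C^1_kA_{\ell,1,k}}{-2n[(\ell-2k)-1]}$ for $1\le k\le h_\ell-1$; $C^j_k=-\frac{C^{j-1}_{k-1}+C^j_{k-1}+C^{j+1}_kA_{\ell,j+1,k}}{A_{\ell,j,k}-2n\{[\ell+2(j-k)]-1\}}$ for $1\le j<k\le h_\ell-1$. *)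

theory Defs
  imports "HOL-Analysis.Analysis" "HOL-Library.Poly_Mapping"
begin

section \<open>Real polynomials on Euclidean space\<close>

text \<open>A polynomial in the coordinates of \<^typ>\<open>real ^ 'n\<close> is a finitely supported map from
  exponent vectors to real coefficients; the zero polynomial is homogeneous of every degree.\<close>

type_synonym 'n rpoly = "('n \<Rightarrow>\<^sub>0 nat) \<Rightarrow>\<^sub>0 real"

definition mdeg :: "('n::finite \<Rightarrow>\<^sub>0 nat) \<Rightarrow> nat" where
  "mdeg m = (\<Sum>i\<in>UNIV. Poly_Mapping.lookup m i)"

definition rpoly_fun :: "'n::finite rpoly \<Rightarrow> real ^ 'n \<Rightarrow> real" where
  "rpoly_fun p y = (\<Sum>m\<in>Poly_Mapping.keys p. Poly_Mapping.lookup p m * (\<Prod>i\<in>UNIV. (y $ i) ^ Poly_Mapping.lookup m i))"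

definition homogeneous :: "nat \<Rightarrow> 'n::finite rpoly \<Rightarrow> bool" where
  "homogeneous d p \<longleftrightarrow> (\<forall>m\<in>Poly_Mapping.keys p. mdeg m = d)"

section \<open>Differential operators\<close>

text \<open>These are total operators (\<^const>\<open>deriv\<close> is arbitrary where no derivative exists); they
  are meant for smooth functions, and below they are applied to polynomial functions only.\<close>

definition partial :: "'n::finite \<Rightarrow> (real ^ 'n \<Rightarrow> real) \<Rightarrow> real ^ 'n \<Rightarrow> real" where
  "partial i f y = deriv (\<lambda>t. f (y + t *\<^sub>R axis i 1)) 0"

definition gradient :: "(real ^ 'n::finite \<Rightarrow> real) \<Rightarrow> real ^ 'n \<Rightarrow> real ^ 'n" where
  "gradient f y = (\<chi> i. partial i f y)"

definition laplacian :: "(real ^ 'n::finite \<Rightarrow> real) \<Rightarrow> real ^ 'n \<Rightarrow> real" where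
  "laplacian f y = (\<Sum>i\<in>UNIV. partial i (partial i f) y)"

section \<open>The coefficients\<close>

text \<open>\<open>coeff_A n l j k\<close> comes from
  \<open>\<Delta> (R\<^sup>2\<^sup>j Q) = coeff_A n l j k * R\<^sup>2\<^sup>j\<^sup>-\<^sup>2 Q + R\<^sup>2\<^sup>j \<Delta> Q\<close> for \<open>Q\<close> homogeneous of degree \<open>l - 2 k\<close>.
  All subtractions are in \<^typ>\<open>real\<close>.\<close>

definition coeff_A :: "nat \<Rightarrow> nat \<Rightarrow> nat \<Rightarrow> nat \<Rightarrow> real" where
  "coeff_A n l j k = (2 * real j) * (2 * real j + real n - 2 + 2 * real l - 4 * real k)"

text \<open>\<open>coeff_C n l j k\<close> has upper index \<open>j\<close> and lower index \<open>k\<close>. Only \<open>j \<le> k < l div 2\<close> is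
  meaningful; the value \<open>0\<close> for \<open>k < j\<close> is a mere totalisation, never reached by the recursion
  from a pair with \<open>j \<le> k\<close>.\<close>

function coeff_C :: "nat \<Rightarrow> nat \<Rightarrow> nat \<Rightarrow> nat \<Rightarrow> real" where
  "coeff_C n l j k =
    (if k < j then 0
     else if k = 0 then - 1 / (2 * real n * (real l - 1))
     else if j = k then
       - coeff_C n l (j - 1) (j - 1) / (coeff_A n l j j - 2 * real n * (real l - 1))
     else if j = 0 then
       - (coeff_C n l 0 (k - 1) + coeff_C n l 1 k * coeff_A n l 1 k)
         / (- 2 * real n * ((real l - 2 * real k) - 1))
     else
       - (coeff_C n l (j - 1) (k - 1) + coeff_C n l j (k - 1)
            + coeff_C n l (j + 1) k * coeff_A n l (j + 1) k)
         / (coeff_A n l j k - 2 * real n * ((real l + 2 * (real j - real k)) - 1)))"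
  by pat_completeness auto
termination
  by (relation "measures [\<lambda>(n, l, j, k). k, \<lambda>(n, l, j, k). k - j]") auto

declare coeff_C.simps [simp del]

lemma coeff_C_0_0: "coeff_C n l 0 0 = - 1 / (2 * real n * (real l - 1))"
  by (subst coeff_C.simps) simp

lemma coeff_C_diag:
  "1 \<le> j \<Longrightarrow> coeff_C n l j j =
     - coeff_C n l (j - 1) (j - 1) / (coeff_A n l j j - 2 * real n * (real l - 1))"
  by (subst coeff_C.simps) simp

lemma coeff_C_0:
  "1 \<le> k \<Longrightarrow> coeff_C n l 0 k =
     - (coeff_C n l 0 (k - 1) + coeff_C n l 1 k * coeff_A n l 1 k)
       / (- 2 * real n * ((real l - 2 * real k) - 1))"
  by (subst coeff_C.simps) simp

lemma coeff_C_step: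
  "1 \<le> j \<Longrightarrow> j < k \<Longrightarrow> coeff_C n l j k =
     - (coeff_C n l (j - 1) (k - 1) + coeff_C n l j (k - 1)
          + coeff_C n l (j + 1) k * coeff_A n l (j + 1) k)
       / (coeff_A n l j k - 2 * real n * ((real l + 2 * (real j - real k)) - 1))"
  by (subst coeff_C.simps) simp

end

theory Submission
  imports Defs
begin

text \<open>With \<open>d = l - 2 k\<close>, the denominator belonging to \<open>(j, k)\<close> factors as \<open>2 (2 j - n) (j + d - 1)\<close>.
  Since \<open>d \<ge> 2\<close> in the relevant range, it vanishes only for \<open>n = 2 j\<close>, which is excluded for odd \<open>n\<close>
  and, by \<open>j < h \<le> n / 2\<close>, for even \<open>n\<close>. The differential operator maps \<open>R\<^sup>2\<^sup>j \<Delta>\<^sup>k P\<close> to a combination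
  of the neighbouring terms of the same type, by Euler's identity and the formula for
  \<open>\<Delta> (R\<^sup>2\<^sup>j Q)\<close>. The recursion makes the contributions containing \<open>\<Delta>\<^sup>k P\<close> cancel, and the
  remaining ones contain \<open>\<Delta>\<^sup>h P = 0\<close>.\<close>

section \<open>Polynomial functions with prescribed degrees\<close>

definition monom_fun :: "('n::finite \<Rightarrow>\<^sub>0 nat) \<Rightarrow> real ^ 'n \<Rightarrow> real" where
  "monom_fun m y = (\<Prod>i\<in>UNIV. (y $ i) ^ Poly_Mapping.lookup m i)"

text \<open>A set of degrees serves two purposes: \<open>{d}\<close> means homogeneous of degree
  \<open>d\<close>, with zero allowed for every \<open>d\<close>, and \<open>{2..l}\<close> later
  encodes all degree claims about the solution at once.\<close>

definition polyfun_deg :: "nat set \<Rightarrow> (real ^ 'n::finite \<Rightarrow> real) \<Rightarrow> bool" where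
  "polyfun_deg D f \<longleftrightarrow> (\<exists>q. mdeg ` Poly_Mapping.keys q \<subseteq> D \<and> f = rpoly_fun q)"

lemma rpoly_fun_superset:
  assumes "finite S" "Poly_Mapping.keys p \<subseteq> S"
  shows "rpoly_fun p y = (\<Sum>m\<in>S. Poly_Mapping.lookup p m * monom_fun m y)"
  unfolding rpoly_fun_def monom_fun_def
  by (rule sum.mono_neutral_left) (use assms in \<open>auto simp: in_keys_iff\<close>)

lemma rpoly_fun_add: "rpoly_fun (p + q) = (\<lambda>y. rpoly_fun p y + rpoly_fun q y)"
proof
  fix y
  let ?S = "Poly_Mapping.keys p \<union> Poly_Mapping.keys q"
  have "Poly_Mapping.keys (p + q) \<subseteq> ?S"
    by (rule Poly_Mapping.keys_add)
  then show "rpoly_fun (p + q) y = rpoly_fun p y + rpoly_fun q y"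
    by (simp add: rpoly_fun_superset[of ?S] lookup_add algebra_simps sum.distrib)
qed

lemma polyfun_deg_zero: "polyfun_deg D (\<lambda>y. 0)"
  unfolding polyfun_deg_def by (rule exI[of _ 0]) (auto simp: rpoly_fun_def)

lemma polyfun_deg_add:
  assumes "polyfun_deg D f" "polyfun_deg D g"
  shows "polyfun_deg D (\<lambda>y. f y + g y)"
proof -
  obtain p q where p: "mdeg ` Poly_Mapping.keys p \<subseteq> D" "f = rpoly_fun p"
    and q: "mdeg ` Poly_Mapping.keys q \<subseteq> D" "g = rpoly_fun q"
    using assms unfolding polyfun_deg_def by blast
  have "mdeg ` Poly_Mapping.keys (p + q) \<subseteq> D"
    using p(1) q(1) Poly_Mapping.keys_add[of p q] by blast
  then show ?thesis
    unfolding polyfun_deg_def p(2) q(2) rpoly_fun_add[symmetric] by blast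
qed

lemma polyfun_deg_monom:
  assumes "mdeg m \<in> D"
  shows "polyfun_deg D (\<lambda>y. c * monom_fun m y)"
  unfolding polyfun_deg_def
  by (rule exI[of _ "Poly_Mapping.single m c"])
    (use assms in \<open>auto simp: rpoly_fun_def monom_fun_def\<close>)

lemma polyfun_deg_sum:
  assumes "finite A" "\<And>a. a \<in> A \<Longrightarrow> polyfun_deg D (f a)"
  shows "polyfun_deg D (\<lambda>y. \<Sum>a\<in>A. f a y)"
  using assms by (induction A rule: finite_induct) (simp_all add: polyfun_deg_zero polyfun_deg_add)

lemma polyfun_deg_mono: "polyfun_deg D f \<Longrightarrow> D \<subseteq> E \<Longrightarrow> polyfun_deg E f"
  unfolding polyfun_deg_def by blast

text \<open>Statements linear in \<open>f\<close> reduce to single monomials. The case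
  \<open>add\<close> keeps the degree facts of both summands, since additivity of derivatives relies
  on them.\<close>

lemma polyfun_deg_induct [consumes 1, case_names zero monom add]:
  assumes "polyfun_deg D f"
    and "P (\<lambda>y. 0)"
    and "\<And>c m. mdeg m \<in> D \<Longrightarrow> P (\<lambda>y. c * monom_fun m y)"
    and "\<And>f g. polyfun_deg D f \<Longrightarrow> polyfun_deg D g \<Longrightarrow> P f \<Longrightarrow> P g \<Longrightarrow> P (\<lambda>y. f y + g y)"
  shows "P f"
proof -
  obtain q where q: "mdeg ` Poly_Mapping.keys q \<subseteq> D" "f = rpoly_fun q"
    using assms(1) unfolding polyfun_deg_def by blast
  \<comment> \<open>Subsets of the support are built up one key at a time, so every partial sum
    stays in the class \<open>D\<close>.\<close>
  have "P (\<lambda>y. \<Sum>m\<in>S. Poly_Mapping.lookup q m * monom_fun m y)"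
    if "finite S" "S \<subseteq> Poly_Mapping.keys q" for S
    using that
  proof (induction S rule: finite_induct)
    case empty
    then show ?case by (simp add: assms(2))
  next
    case (insert m S)
    have "polyfun_deg D (\<lambda>y. \<Sum>m\<in>S. Poly_Mapping.lookup q m * monom_fun m y)"
      using insert.hyps insert.prems q(1) by (intro polyfun_deg_sum polyfun_deg_monom) auto
    moreover have "mdeg m \<in> D"
      using insert.prems q(1) by auto
    ultimately show ?case
      using insert by (simp add: assms(3,4) polyfun_deg_monom)
  qed
  moreover have "rpoly_fun q =
      (\<lambda>y. \<Sum>m\<in>Poly_Mapping.keys q. Poly_Mapping.lookup q m * monom_fun m y)"
    by (rule ext) (simp add: rpoly_fun_def monom_fun_def)
  ultimately show ?thesis
    using q(2) by simp
qed

lemma polyfun_deg_cmult: "polyfun_deg D f \<Longrightarrow> polyfun_deg D (\<lambda>y. c * f y)"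
proof (induction rule: polyfun_deg_induct)
  case (monom b m)
  then show ?case
    using polyfun_deg_monom[of m D "c * b"] by (simp add: mult.assoc)
qed (simp_all add: polyfun_deg_zero polyfun_deg_add distrib_left)

lemma polyfun_deg_homogeneous: "homogeneous d p \<Longrightarrow> polyfun_deg {d} (rpoly_fun p)"
  unfolding polyfun_deg_def homogeneous_def by blast

lemma mdeg_add_single: "mdeg (m + Poly_Mapping.single i 1) = Suc (mdeg m)"
  by (simp add: mdeg_def lookup_add sum.distrib lookup_single when_def)

lemma monom_fun_add_single: "monom_fun (m + Poly_Mapping.single i 1) y = y $ i * monom_fun m y"
proof -
  have "(\<Prod>k\<in>UNIV. y $ k ^ (1 when i = k)) = (\<Prod>k\<in>UNIV. if i = k then y $ k else 1)"
    by (rule prod.cong) (auto simp: when_def)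
  then show ?thesis
    by (simp add: monom_fun_def lookup_add lookup_single power_add prod.distrib)
qed

lemma polyfun_deg_coord_mult:
  "polyfun_deg D f \<Longrightarrow> polyfun_deg (Suc ` D) (\<lambda>y. y $ i * f y)"
proof (induction rule: polyfun_deg_induct)
  case (monom c m)
  then show ?case
    using polyfun_deg_monom[of "m + Poly_Mapping.single i 1" "Suc ` D" c]
    by (simp add: mdeg_add_single monom_fun_add_single mult.left_commute del: One_nat_def)
qed (simp_all add: polyfun_deg_zero polyfun_deg_add distrib_left)

lemma norm_vec_square: "(norm (y :: real ^ 'n::finite))\<^sup>2 = (\<Sum>i\<in>UNIV. (y $ i)\<^sup>2)"
  by (simp add: norm_vec_def L2_set_def sum_nonneg)

text \<open>Writing the squared norm as a sum of \<open>y $ i * y $ i\<close> reduces this to two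
  exponent shifts per coordinate.\<close>

lemma polyfun_deg_norm_square_mult:
  assumes "polyfun_deg {d} f"
  shows "polyfun_deg {d + 2} (\<lambda>y. (norm y)\<^sup>2 * f y)"
proof -
  have "polyfun_deg {d + 2} (\<lambda>y. \<Sum>i\<in>UNIV. y $ i * (y $ i * f y))"
    using polyfun_deg_coord_mult[OF polyfun_deg_coord_mult[OF assms]]
    by (intro polyfun_deg_sum) auto
  moreover have "(norm y)\<^sup>2 * f y = (\<Sum>i\<in>UNIV. y $ i * (y $ i * f y))" for y
    unfolding norm_vec_square sum_distrib_right by (simp add: power2_eq_square mult.assoc)
  ultimately show ?thesis
    by simp
qed

lemma polyfun_deg_norm_power_mult:
  assumes "polyfun_deg {d} f"
  shows "polyfun_deg {d + 2 * j} (\<lambda>y. ((norm y)\<^sup>2) ^ j * f y)"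
proof (induction j)
  case (Suc j)
  then show ?case
    using polyfun_deg_norm_square_mult[OF Suc] by (simp add: mult.assoc)
qed (use assms in simp)

section \<open>Partial derivatives of polynomial functions\<close>

text \<open>If the exponent of coordinate \<open>i\<close> is zero, the truncated subtraction of exponents is harmless
  because of the zero factor.\<close>

lemma monom_fun_has_partial:
  "((\<lambda>t. monom_fun m (y + t *\<^sub>R axis i 1)) has_field_derivative
     real (Poly_Mapping.lookup m i) * monom_fun (m - Poly_Mapping.single i 1) y) (at 0)"
proof -
  let ?c = "\<Prod>k\<in>UNIV - {i}. (y $ k) ^ Poly_Mapping.lookup m k"
  let ?e = "Poly_Mapping.lookup m i"
  \<comment> \<open>Along the line in direction \<open>i\<close> only the factor of coordinate
    \<open>i\<close> varies; the product \<open>?c\<close> of the others is constant.\<close>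
  have eq: "monom_fun m (y + t *\<^sub>R axis i 1) = (y $ i + t) ^ ?e * ?c" for t
  proof -
    have "(\<Prod>k\<in>UNIV - {i}. ((y + t *\<^sub>R axis i 1) $ k) ^ Poly_Mapping.lookup m k) = ?c"
      by (rule prod.cong) (auto simp: axis_def)
    then show ?thesis
      unfolding monom_fun_def by (subst prod.remove[of _ i]) (auto simp: axis_def)
  qed
  have "monom_fun (m - Poly_Mapping.single i 1) y = (y $ i) ^ (?e - 1) * ?c"
  proof -
    have "(\<Prod>k\<in>UNIV - {i}. (y $ k) ^ Poly_Mapping.lookup (m - Poly_Mapping.single i 1) k) = ?c"
      by (rule prod.cong) (auto simp: lookup_minus lookup_single)
    then show ?thesis
      unfolding monom_fun_def by (subst prod.remove[of _ i]) (auto simp: lookup_minus)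
  qed
  moreover have "((\<lambda>t. (y $ i + t) ^ ?e * c) has_field_derivative
      real ?e * ((y $ i) ^ (?e - 1) * c)) (at 0)" for c
    by (auto intro!: derivative_eq_intros)
  ultimately show ?thesis
    unfolding eq by simp
qed

lemma partial_monom:
  "partial i (\<lambda>y. c * monom_fun m y) =
     (\<lambda>y. c * real (Poly_Mapping.lookup m i) * monom_fun (m - Poly_Mapping.single i 1) y)"
proof
  fix y
  show "partial i (\<lambda>y. c * monom_fun m y) y =
      c * real (Poly_Mapping.lookup m i) * monom_fun (m - Poly_Mapping.single i 1) y"
    using DERIV_imp_deriv[OF DERIV_cmult[OF monom_fun_has_partial[of m y i], of c]]
    unfolding partial_def mult.assoc .
qed

text \<open>As \<open>deriv\<close> is total, existence of a derivative is proved first, by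
  induction on the polynomial; uniqueness then identifies it with \<open>partial\<close>.\<close>

lemma polyfun_has_partial:
  "polyfun_deg D f \<Longrightarrow>
     ((\<lambda>t. f (y + t *\<^sub>R axis i 1)) has_field_derivative partial i f y) (at 0)"
proof -
  assume "polyfun_deg D f"
  then have "\<exists>c. ((\<lambda>t. f (y + t *\<^sub>R axis i 1)) has_field_derivative c) (at 0)"
  proof (induction rule: polyfun_deg_induct)
    case zero
    show ?case by (rule exI, rule DERIV_const)
  next
    case (monom c m)
    show ?case using DERIV_cmult[OF monom_fun_has_partial[of m y i], of c] by (rule exI)
  next
    case (add f g)
    then obtain a b where "((\<lambda>t. f (y + t *\<^sub>R axis i 1)) has_field_derivative a) (at 0)"
      "((\<lambda>t. g (y + t *\<^sub>R axis i 1)) has_field_derivative b) (at 0)" by blast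
    from DERIV_add[OF this] show ?case by (rule exI)
  qed
  then obtain c where "((\<lambda>t. f (y + t *\<^sub>R axis i 1)) has_field_derivative c) (at 0)" ..
  moreover from this have "partial i f y = c"
    unfolding partial_def by (rule DERIV_imp_deriv)
  ultimately show ?thesis by simp
qed

lemma partial_zero: "partial i (\<lambda>y. 0) = (\<lambda>y. 0)"
  by (simp add: partial_def fun_eq_iff)

text \<open>Two degree sets are allowed because the rule is later applied to summands whose recorded
  degrees are \<open>Suc d\<close> and \<open>d - 1 + 2\<close>, which differ for
  \<open>d = 0\<close>.\<close>

lemma partial_add:
  assumes "polyfun_deg D f" "polyfun_deg E g"
  shows "partial i (\<lambda>y. f y + g y) = (\<lambda>y. partial i f y + partial i g y)"
proof
  fix y
  show "partial i (\<lambda>y. f y + g y) y = partial i f y + partial i g y"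
    using DERIV_imp_deriv[OF DERIV_add[OF polyfun_has_partial[OF assms(1), of y i]
          polyfun_has_partial[OF assms(2), of y i]]]
    unfolding partial_def[of i "\<lambda>y. f y + g y"] .
qed

lemma partial_cmult:
  assumes "polyfun_deg D f"
  shows "partial i (\<lambda>y. c * f y) = (\<lambda>y. c * partial i f y)"
proof
  fix y
  show "partial i (\<lambda>y. c * f y) y = c * partial i f y"
    using DERIV_imp_deriv[OF DERIV_cmult[OF polyfun_has_partial[OF assms, of y i]]]
    unfolding partial_def[of i "\<lambda>y. c * f y"] .
qed

lemma diff_single_add_single:
  fixes m :: "'a \<Rightarrow>\<^sub>0 nat"
  assumes "Poly_Mapping.lookup m i \<noteq> 0"
  shows "m - Poly_Mapping.single i 1 + Poly_Mapping.single i 1 = m"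
  by (rule poly_mapping_eqI)
    (use assms in \<open>auto simp: lookup_add lookup_minus lookup_single when_def\<close>)

lemma mdeg_diff_single:
  assumes "Poly_Mapping.lookup m i \<noteq> 0"
  shows "mdeg (m - Poly_Mapping.single i 1) = mdeg m - 1"
  using mdeg_add_single[of "m - Poly_Mapping.single i 1" i]
  unfolding diff_single_add_single[OF assms] by simp

lemma polyfun_deg_partial:
  "polyfun_deg D f \<Longrightarrow> polyfun_deg ((\<lambda>d. d - 1) ` D) (partial i f)"
proof (induction rule: polyfun_deg_induct)
  case (monom c m)
  show ?case
  \<comment> \<open>With exponent zero the truncated difference leaves \<open>m\<close> unchanged
    and lowers no degree; the derivative is then zero, which belongs to every class.\<close>
  proof (cases "Poly_Mapping.lookup m i = 0")
    case True
    then show ?thesis by (simp add: partial_monom polyfun_deg_zero)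
  next
    case False
    then show ?thesis
      using monom unfolding partial_monom
      by (intro polyfun_deg_monom) (auto simp only: mdeg_diff_single intro: imageI)
  qed
qed (simp_all add: partial_zero partial_add polyfun_deg_zero polyfun_deg_add)

section \<open>Laplacian and gradient: degrees, linearity and Euler's identity\<close>

lemma polyfun_deg_laplacian:
  assumes "polyfun_deg {d} f"
  shows "polyfun_deg {d - 2} (laplacian f)"
proof -
  have "polyfun_deg {d - 2} (partial i (partial i f))" for i
    using polyfun_deg_partial[OF polyfun_deg_partial[OF assms]] by (simp add: numeral_2_eq_2)
  then show ?thesis
    unfolding laplacian_def[abs_def] by (intro polyfun_deg_sum) auto
qed

lemma polyfun_deg_laplacian_iter:
  assumes "polyfun_deg {d} f"
  shows "polyfun_deg {d - 2 * k} ((laplacian ^^ k) f)"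
proof (induction k)
  case (Suc k)
  then show ?case
    using polyfun_deg_laplacian[OF Suc] by simp
qed (use assms in simp)

lemma laplacian_add:
  assumes "polyfun_deg D f" "polyfun_deg E g"
  shows "laplacian (\<lambda>y. f y + g y) y = laplacian f y + laplacian g y"
  by (simp add: laplacian_def partial_add[OF assms] sum.distrib
      partial_add[OF polyfun_deg_partial[OF assms(1)] polyfun_deg_partial[OF assms(2)]])

lemma laplacian_cmult:
  assumes "polyfun_deg D f"
  shows "laplacian (\<lambda>y. c * f y) y = c * laplacian f y"
  by (simp add: laplacian_def partial_cmult[OF assms] sum_distrib_left
      partial_cmult[OF polyfun_deg_partial[OF assms]])

lemma gradient_add:
  assumes "polyfun_deg D f" "polyfun_deg E g"
  shows "gradient (\<lambda>y. f y + g y) y = gradient f y + gradient g y"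
  by (simp add: gradient_def partial_add[OF assms] vec_eq_iff)

lemma gradient_cmult:
  assumes "polyfun_deg D f"
  shows "gradient (\<lambda>y. c * f y) y = c *\<^sub>R gradient f y"
  by (simp add: gradient_def partial_cmult[OF assms] vec_eq_iff)

text \<open>Euler's identity for one coordinate of a monomial: multiplying by \<open>y $ i\<close>
  restores the exponent that differentiation lowered. Summing the exponents over \<open>i\<close>
  gives the degree.\<close>

lemma coord_mult_monom_diff_single:
  "y $ i * (real (Poly_Mapping.lookup m i) * monom_fun (m - Poly_Mapping.single i 1) y) =
     real (Poly_Mapping.lookup m i) * monom_fun m y"
proof (cases "Poly_Mapping.lookup m i = 0")
  case False
  show ?thesis
    using monom_fun_add_single[of "m - Poly_Mapping.single i 1" i y]
    unfolding diff_single_add_single[OF False] by simp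
qed simp

lemma euler_identity: "polyfun_deg {d} f \<Longrightarrow> y \<bullet> gradient f y = real d * f y"
proof (induction rule: polyfun_deg_induct)
  case zero
  then show ?case by (simp add: gradient_def partial_zero inner_vec_def)
next
  case (monom c m)
  have "y \<bullet> gradient (\<lambda>y. c * monom_fun m y) y
      = c * (\<Sum>i\<in>UNIV. y $ i * (real (Poly_Mapping.lookup m i) *
          monom_fun (m - Poly_Mapping.single i 1) y))"
    by (simp add: gradient_def partial_monom inner_vec_def sum_distrib_left mult_ac)
  also have "\<dots> = c * (real (mdeg m) * monom_fun m y)"
    unfolding coord_mult_monom_diff_single by (simp add: mdeg_def sum_distrib_right)
  finally show ?case using monom by simp
next
  case (add f g)
  then show ?case by (simp add: gradient_add inner_add_right distrib_left)
qed

section \<open>The Laplacian of a product with a power of the squared norm\<close>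

lemma norm_square_has_partial:
  "((\<lambda>t. (norm (y + t *\<^sub>R axis i 1))\<^sup>2) has_field_derivative 2 * y $ i) (at 0)"
  for y :: "real ^ 'n::finite"
proof -
  have "(norm (y + t *\<^sub>R axis i 1))\<^sup>2 = (norm y)\<^sup>2 + 2 * t * y $ i + t\<^sup>2" for t
    unfolding power2_norm_eq_inner
    by (simp add: inner_add_left inner_add_right inner_axis inner_axis' power2_eq_square
        distrib_left)
  then show ?thesis
    by (auto intro!: derivative_eq_intros)
qed

lemma coord_has_partial:
  "((\<lambda>t. (y + t *\<^sub>R axis i 1) $ i) has_field_derivative 1) (at 0)"
  for y :: "real ^ 'n::finite"
  by (auto simp: axis_def intro!: derivative_eq_intros)

lemma partial_norm_square_mult:
  assumes "polyfun_deg D f"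
  shows "partial i (\<lambda>y. (norm y)\<^sup>2 * f y) = (\<lambda>y. 2 * (y $ i * f y) + (norm y)\<^sup>2 * partial i f y)"
proof
  fix y
  show "partial i (\<lambda>y. (norm y)\<^sup>2 * f y) y = 2 * (y $ i * f y) + (norm y)\<^sup>2 * partial i f y"
    using DERIV_imp_deriv[OF DERIV_mult[OF norm_square_has_partial[of y i]
          polyfun_has_partial[OF assms, of y i]]]
    unfolding partial_def[of i "\<lambda>y. (norm y)\<^sup>2 * f y"] by (simp add: mult_ac)
qed

lemma partial_coord_mult:
  assumes "polyfun_deg D f"
  shows "partial i (\<lambda>y. y $ i * f y) = (\<lambda>y. f y + y $ i * partial i f y)"
proof
  fix y
  show "partial i (\<lambda>y. y $ i * f y) y = f y + y $ i * partial i f y"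
    using DERIV_imp_deriv[OF DERIV_mult[OF coord_has_partial[of y i]
          polyfun_has_partial[OF assms, of y i]]]
    unfolding partial_def[of i "\<lambda>y. y $ i * f y"] by (simp add: mult_ac)
qed

lemma laplacian_norm_square_mult:
  fixes f :: "real ^ 'n::finite \<Rightarrow> real"
  assumes f: "polyfun_deg {d} f"
  shows "laplacian (\<lambda>y. (norm y)\<^sup>2 * f y) y =
    (2 * real CARD('n) + 4 * real d) * f y + (norm y)\<^sup>2 * laplacian f y"
proof -
  have "partial i (partial i (\<lambda>y. (norm y)\<^sup>2 * f y)) y
      = 2 * f y + 4 * (y $ i * partial i f y) + (norm y)\<^sup>2 * partial i (partial i f) y" for i
  proof -
    note pf = polyfun_deg_partial[OF f, of i]
    have n: "polyfun_deg {d - 1 + 2} (\<lambda>y. (norm y)\<^sup>2 * partial i f y)"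
      using pf by (intro polyfun_deg_norm_square_mult) simp
    note c = polyfun_deg_coord_mult[OF f, of i]
    show ?thesis
      by (simp add: partial_norm_square_mult[OF f] partial_add[OF polyfun_deg_cmult[OF c] n]
          partial_cmult[OF c] partial_coord_mult[OF f] partial_norm_square_mult[OF pf])
  qed
  \<comment> \<open>Summation over \<open>i\<close> turns the mixed terms into the Euler field,
    which contributes \<open>4 d\<close> to the factor of \<open>f\<close>.\<close>
  then have "laplacian (\<lambda>y. (norm y)\<^sup>2 * f y) y
      = 2 * real CARD('n) * f y + 4 * (y \<bullet> gradient f y) + (norm y)\<^sup>2 * laplacian f y"
    by (simp add: laplacian_def sum.distrib gradient_def inner_vec_def sum_distrib_left)
  then show ?thesis
    by (simp add: euler_identity[OF f] algebra_simps)
qed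

text \<open>For \<open>j = 0\<close> the coefficient of the first summand vanishes, so the truncated exponent \<open>j - 1\<close>
  does not matter.\<close>

lemma laplacian_norm_power_mult:
  fixes f :: "real ^ 'n::finite \<Rightarrow> real"
  assumes f: "polyfun_deg {d} f"
  shows "laplacian (\<lambda>y. ((norm y)\<^sup>2) ^ j * f y) y =
    2 * real j * (2 * real j + real CARD('n) - 2 + 2 * real d) * (((norm y)\<^sup>2) ^ (j - 1) * f y)
      + ((norm y)\<^sup>2) ^ j * laplacian f y"
proof (induction j)
  case (Suc j)
  let ?x = "(norm y)\<^sup>2"
  \<comment> \<open>For \<open>j = 0\<close> the product of \<open>?x\<close> and
    \<open>?x ^ (j - 1)\<close> is not \<open>?x ^ j\<close>, but the factor \<open>real j\<close>
    vanishes.\<close>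
  have absorb: "?x * (2 * real j * a * (?x ^ (j - 1) * b) + c) =
      2 * real j * a * (?x ^ j * b) + ?x * c" for a b c
    by (cases j) (simp_all add: distrib_left)
  have "laplacian (\<lambda>y. ((norm y)\<^sup>2) ^ Suc j * f y) y
      = (2 * real CARD('n) + 4 * real (d + 2 * j)) * (?x ^ j * f y)
        + ?x * laplacian (\<lambda>y. ((norm y)\<^sup>2) ^ j * f y) y"
    using laplacian_norm_square_mult[OF polyfun_deg_norm_power_mult[OF f, of j], of y]
    by (simp add: mult.assoc)
  then show ?case
    unfolding Suc.IH absorb by (simp add: algebra_simps)
qed simp

section \<open>The operator and the recursion\<close>

definition gamma_op :: "(real ^ 'n::finite \<Rightarrow> real) \<Rightarrow> real ^ 'n \<Rightarrow> real" where
  "gamma_op f y = (1 + (norm y)\<^sup>2) * laplacian f y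
     - 2 * real CARD('n) * (y \<bullet> gradient f y) + 2 * real CARD('n) * f y"

lemma gamma_op_zero: "gamma_op (\<lambda>y. 0) y = 0"
  by (simp add: gamma_op_def laplacian_def gradient_def partial_zero inner_vec_def)

lemma gamma_op_add:
  assumes "polyfun_deg D f" "polyfun_deg D g"
  shows "gamma_op (\<lambda>y. f y + g y) y = gamma_op f y + gamma_op g y"
  by (simp add: gamma_op_def laplacian_add[OF assms] gradient_add[OF assms] inner_add_right
      algebra_simps)

lemma gamma_op_cmult:
  assumes "polyfun_deg D f"
  shows "gamma_op (\<lambda>y. c * f y) y = c * gamma_op f y"
  by (simp add: gamma_op_def laplacian_cmult[OF assms] gradient_cmult[OF assms] algebra_simps)

lemma gamma_op_sum:
  assumes "finite A" "\<And>a. a \<in> A \<Longrightarrow> polyfun_deg D (f a)"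
  shows "gamma_op (\<lambda>y. \<Sum>a\<in>A. f a y) y = (\<Sum>a\<in>A. gamma_op (f a) y)"
  using assms
  by (induction A rule: finite_induct)
    (simp_all add: gamma_op_zero gamma_op_add[where D = D] polyfun_deg_sum)

text \<open>One formula for all denominators of the recursion: \<open>coeff_A\<close> vanishes at
  \<open>j = 0\<close>, and \<open>j - k\<close> vanishes on the diagonal. At \<open>(0, 0)\<close>
  it is the negative of the denominator in \<open>coeff_C_0_0\<close>.\<close>

definition denom :: "nat \<Rightarrow> nat \<Rightarrow> nat \<Rightarrow> nat \<Rightarrow> real" where
  "denom n l j k = coeff_A n l j k - 2 * real n * ((real l + 2 * (real j - real k)) - 1)"

lemma denom_factor:
  "denom n l j k = 2 * (2 * real j - real n) * (real j + (real l - 2 * real k) - 1)"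
  by (simp add: denom_def coeff_A_def algebra_simps)

text \<open>The product has degree \<open>l + 2 (j - k)\<close>, so the Euler and zeroth-order terms
  add \<open>- 2 n (degree - 1)\<close> to the factor \<open>coeff_A\<close> that the squared norm
  returns to power \<open>j\<close>; together they form \<open>denom\<close>.\<close>

lemma gamma_op_norm_power_mult:
  fixes f :: "real ^ 'n::finite \<Rightarrow> real"
  assumes f: "polyfun_deg {l - 2 * k} f" and "2 * k \<le> l"
  shows "gamma_op (\<lambda>y. ((norm y)\<^sup>2) ^ j * f y) y =
    (coeff_A CARD('n) l j k * ((norm y)\<^sup>2) ^ (j - 1) + denom CARD('n) l j k * ((norm y)\<^sup>2) ^ j) * f y
      + (((norm y)\<^sup>2) ^ j + ((norm y)\<^sup>2) ^ Suc j) * laplacian f y"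
proof -
  let ?x = "(norm y)\<^sup>2"
  let ?A = "coeff_A CARD('n) l j k"
  have A: "2 * real j * (2 * real j + real CARD('n) - 2 + 2 * real (l - 2 * k)) = ?A"
    using assms(2) by (simp add: coeff_A_def of_nat_diff algebra_simps)
  have absorb: "?x * (?A * (?x ^ (j - 1) * b)) = ?A * (?x ^ j * b)" for b
    by (cases j) (simp_all add: coeff_A_def)
  have "gamma_op (\<lambda>y. ((norm y)\<^sup>2) ^ j * f y) y =
      (1 + ?x) * (?A * (?x ^ (j - 1) * f y) + ?x ^ j * laplacian f y)
      - 2 * real CARD('n) * (real (l - 2 * k + 2 * j) * (?x ^ j * f y))
      + 2 * real CARD('n) * (?x ^ j * f y)"
    unfolding gamma_op_def laplacian_norm_power_mult[OF f] A
      euler_identity[OF polyfun_deg_norm_power_mult[OF f, of j]] ..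
  also have "\<dots> = ?A * (?x ^ (j - 1) * f y) + ?A * (?x ^ j * f y)
      + (?x ^ j + ?x ^ Suc j) * laplacian f y
      - 2 * real CARD('n) * ((real l + 2 * (real j - real k)) - 1) * (?x ^ j * f y)"
    unfolding distrib_right[of 1] distrib_left[of ?x] absorb
    using assms(2) by (simp add: of_nat_diff algebra_simps)
  also have "\<dots> = (?A * ?x ^ (j - 1) + denom CARD('n) l j k * ?x ^ j) * f y
      + (?x ^ j + ?x ^ Suc j) * laplacian f y"
    by (simp add: denom_def algebra_simps)
  finally show ?thesis .
qed

section \<open>Cancellation through the coefficient recursion\<close>

lemma coeff_C_above_diag: "k < j \<Longrightarrow> coeff_C n l j k = 0"
  by (subst coeff_C.simps) simp

text \<open>A division-free form uniting the three recursive cases. The \<open>case\<close>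
  expression replaces the absent upper index \<open>-1\<close> by zero, and zeros above the diagonal
  remove the surplus terms when \<open>j = Suc k\<close>.\<close>

lemma coeff_C_denom:
  assumes "denom n l j (Suc k) \<noteq> 0" "j \<le> Suc k"
  shows "coeff_C n l j (Suc k) * denom n l j (Suc k) =
    - ((case j of 0 \<Rightarrow> 0 | Suc i \<Rightarrow> coeff_C n l i k) + coeff_C n l j k
        + coeff_C n l (Suc j) (Suc k) * coeff_A n l (Suc j) (Suc k))"
proof (cases j)
  case 0
  have "denom n l 0 (Suc k) = - 2 * real n * ((real l - 2 * real (Suc k)) - 1)"
    by (simp add: denom_def coeff_A_def algebra_simps)
  then show ?thesis
    using coeff_C_0[of "Suc k" n l] assms 0 by (simp del: of_nat_Suc)
next
  case (Suc i)
  show ?thesis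
  proof (cases "j = Suc k")
    case True
    have "denom n l j (Suc k) = coeff_A n l (Suc k) (Suc k) - 2 * real n * (real l - 1)"
      by (simp add: denom_def True)
    then show ?thesis
      using coeff_C_diag[of "Suc k" n l] assms Suc True by (simp add: coeff_C_above_diag)
  next
    case False
    then show ?thesis
      using coeff_C_step[of j "Suc k" n l] assms Suc
      unfolding denom_def by (simp del: of_nat_Suc)
  qed
qed

text \<open>Here \<open>x\<close> stands for the squared norm. The left side is the factor of the
  iterate \<open>Suc k\<close> from its own block; it cancels what block \<open>k\<close> passes on.
  The proof matches powers of \<open>x\<close> using the uniform recursion.\<close>

lemma recursion_cancel:
  fixes x :: real
  assumes "\<And>j. j \<le> Suc k \<Longrightarrow> denom n l j (Suc k) \<noteq> 0"
  shows "(\<Sum>j\<le>Suc k. coeff_C n l j (Suc k) *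
            (coeff_A n l j (Suc k) * x ^ (j - 1) + denom n l j (Suc k) * x ^ j))
       = - (\<Sum>j\<le>k. coeff_C n l j k * (x ^ j + x ^ Suc j))"
proof -
  let ?a = "\<lambda>j. coeff_C n l j (Suc k) * coeff_A n l j (Suc k)"
  let ?c = "\<lambda>j. case j of 0 \<Rightarrow> 0 | Suc i \<Rightarrow> coeff_C n l i k"
  \<comment> \<open>The shift adds the index \<open>0\<close>, where \<open>coeff_A\<close>
    vanishes, and drops the top index, where \<open>coeff_C\<close> lies above the diagonal.\<close>
  have shift: "(\<Sum>j\<le>Suc k. ?a (Suc j) * x ^ j) = (\<Sum>j\<le>Suc k. ?a j * x ^ (j - 1))"
  proof -
    have "(\<Sum>j\<le>Suc k. ?a (Suc j) * x ^ j) = (\<Sum>j\<le>Suc (Suc k). ?a j * x ^ (j - 1))"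
      by (subst sum.atMost_Suc_shift[of _ "Suc k"]) (simp add: coeff_A_def)
    then show ?thesis by (simp add: coeff_C_above_diag)
  qed
  have prev: "(\<Sum>j\<le>Suc k. ?c j * x ^ j) = (\<Sum>j\<le>k. coeff_C n l j k * x ^ Suc j)"
    by (subst sum.atMost_Suc_shift) simp
  have "(\<Sum>j\<le>Suc k. coeff_C n l j (Suc k) * denom n l j (Suc k) * x ^ j)
      = (\<Sum>j\<le>Suc k. - (?c j * x ^ j) - coeff_C n l j k * x ^ j - ?a (Suc j) * x ^ j)"
    by (intro sum.cong refl, subst coeff_C_denom)
      (use assms in \<open>auto simp: algebra_simps\<close>)
  also have "\<dots> = - (\<Sum>j\<le>k. coeff_C n l j k * x ^ Suc j) - (\<Sum>j\<le>k. coeff_C n l j k * x ^ j)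
      - (\<Sum>j\<le>Suc k. ?a j * x ^ (j - 1))"
    unfolding sum_subtractf sum_negf prev shift by (simp add: coeff_C_above_diag)
  finally show ?thesis
    by (simp add: distrib_left sum.distrib mult.assoc del: sum.atMost_Suc)
qed

text \<open>At a fixed point, with \<open>Q k\<close> the value of the \<open>k\<close>-th iterate,
  the identity is pure algebra. Each new block cancels the current remainder and leaves one in the
  next iterate.\<close>

lemma recursion_telescope:
  fixes x :: real and Q :: "nat \<Rightarrow> real"
  assumes "\<And>j k. j \<le> k \<Longrightarrow> k \<le> m \<Longrightarrow> denom n l j k \<noteq> 0"
  shows "(\<Sum>k\<le>m. \<Sum>j\<le>k. coeff_C n l j k *
            ((coeff_A n l j k * x ^ (j - 1) + denom n l j k * x ^ j) * Q k
              + (x ^ j + x ^ Suc j) * Q (Suc k)))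
       = Q 0 + (\<Sum>j\<le>m. coeff_C n l j m * (x ^ j + x ^ Suc j)) * Q (Suc m)"
  using assms
proof (induction m)
  case 0
  have "denom n l 0 0 \<noteq> 0" using 0 by simp
  \<comment> \<open>The initial coefficient is normalised so that \<open>Q 0\<close>, the right-hand
    side of the equation, appears with factor one.\<close>
  then have "coeff_C n l 0 0 * denom n l 0 0 = 1"
    by (simp add: coeff_C_0_0 denom_def coeff_A_def)
  then show ?case by (simp add: coeff_A_def algebra_simps)
next
  case (Suc m)
  let ?u = "\<lambda>j. coeff_C n l j (Suc m) *
    (coeff_A n l j (Suc m) * x ^ (j - 1) + denom n l j (Suc m) * x ^ j)"
  let ?t = "\<lambda>k j. coeff_C n l j k * (x ^ j + x ^ Suc j)"
  have "(\<Sum>j\<le>Suc m. coeff_C n l j (Suc m) *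
            ((coeff_A n l j (Suc m) * x ^ (j - 1) + denom n l j (Suc m) * x ^ j) * Q (Suc m)
              + (x ^ j + x ^ Suc j) * Q (Suc (Suc m))))
      = (\<Sum>j\<le>Suc m. ?u j) * Q (Suc m) + (\<Sum>j\<le>Suc m. ?t (Suc m) j) * Q (Suc (Suc m))"
    unfolding sum_distrib_right sum.distrib[symmetric]
    by (intro sum.cong refl) (simp add: algebra_simps)
  also have "(\<Sum>j\<le>Suc m. ?u j) = - (\<Sum>j\<le>m. ?t m j)"
    by (rule recursion_cancel) (use Suc.prems in auto)
  finally show ?case
    using Suc by (subst sum.atMost_Suc) simp
qed

section \<open>Construction of the polynomial solution\<close>

theorem proposition4p49:
  fixes p :: "'n::finite rpoly" and P :: "real ^ 'n \<Rightarrow> real" and n l h :: nat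
  assumes n_def: "n = CARD('n)" and n_ge: "n \<ge> 3"
    and hom: "homogeneous l p" and P_def: "P = rpoly_fun p"
    and h_def: "h = l div 2"
    and i: "even n \<longrightarrow> 2 \<le> l \<and> l < n + 2 \<and> (\<forall>y. (laplacian ^^ h) P y = 0)"
    and ii: "odd n \<longrightarrow> 2 \<le> l \<and> (\<forall>y. (laplacian ^^ h) P y = 0)"
  shows "\<exists>g :: 'n rpoly.
      rpoly_fun g = (\<lambda>y. \<Sum>k = 0..h - 1. \<Sum>j = 0..k.
        coeff_C n l j k * ((norm y)\<^sup>2) ^ j * (laplacian ^^ k) P y)
    \<and> (\<forall>y. (1 + (norm y)\<^sup>2) * laplacian (rpoly_fun g) y
            - 2 * real n * (y \<bullet> gradient (rpoly_fun g) y)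
            + 2 * real n * rpoly_fun g y = P y)
    \<and> Poly_Mapping.lookup g 0 = 0
    \<and> (\<forall>i. Poly_Mapping.lookup g (Poly_Mapping.single i 1) = 0)
    \<and> (\<forall>m\<in>Poly_Mapping.keys g. mdeg m \<le> l)"
proof -
  define Q where "Q k = (laplacian ^^ k) P" for k
  have l2: "2 \<le> l" and Qh: "Q h y = 0" for y
    using i ii by (auto simp: Q_def)
  have "h \<noteq> 0"
    using l2 h_def by linarith
  \<comment> \<open>The bound \<open>2 \<le> l\<close> makes \<open>h\<close> positive, so
    \<open>h - 1\<close> is not truncated.\<close>
  then obtain m where m: "h = Suc m"
    by (cases h) auto
  have le: "2 * k + 2 \<le> l" if "k \<le> m" for k
    using that m h_def by linarith
  have nz: "denom n l j k \<noteq> 0" if jk: "j \<le> k" "k \<le> m" for j k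
  proof -
    \<comment> \<open>Equality would make \<open>n\<close> even, hence \<open>l < 2 j + 2\<close>,
      contradicting \<open>2 k + 2 \<le> l\<close> and \<open>j \<le> k\<close>.\<close>
    have "n \<noteq> 2 * j"
    proof
      assume n: "n = 2 * j"
      then have "l < n + 2" using i by simp
      then show False using n jk le[of m] by linarith
    qed
    then have "2 * real j - real n \<noteq> 0"
      by linarith
    moreover have "real j + (real l - 2 * real k) - 1 \<noteq> 0"
      using le[OF jk(2)] by linarith
    ultimately show ?thesis
      by (simp add: denom_factor)
  qed
  have Q_Suc: "Q (Suc k) = laplacian (Q k)" for k
    by (simp add: Q_def)
  have Q: "polyfun_deg {l - 2 * k} (Q k)" for k
    unfolding Q_def P_def using hom by (intro polyfun_deg_laplacian_iter polyfun_deg_homogeneous)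
  let ?F = "\<lambda>k j y. coeff_C n l j k * (((norm y)\<^sup>2) ^ j * Q k y)"
  let ?G = "\<lambda>y. \<Sum>k\<le>m. \<Sum>j\<le>k. ?F k j y"
  note T = polyfun_deg_norm_power_mult[OF Q]
  \<comment> \<open>The degree \<open>l - 2 k + 2 j\<close> is at most \<open>l\<close> by
    \<open>j \<le> k\<close> and at least \<open>2\<close> by
    \<open>2 k + 2 \<le> l\<close>.\<close>
  have F: "polyfun_deg {2..l} (?F k j)" if "j \<le> k" "k \<le> m" for j k
    by (rule polyfun_deg_mono[OF polyfun_deg_cmult[OF T]]) (use that le[of k] in auto)
  have "polyfun_deg {2..l} ?G"
    by (intro polyfun_deg_sum) (use F in auto)
  then obtain g where keys: "mdeg ` Poly_Mapping.keys g \<subseteq> {2..l}" and g: "rpoly_fun g = ?G"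
    unfolding polyfun_deg_def by metis
  have "gamma_op ?G y = P y" for y
  proof -
    have "gamma_op ?G y = (\<Sum>k\<le>m. gamma_op (\<lambda>y. \<Sum>j\<le>k. ?F k j y) y)"
      by (rule gamma_op_sum) (use F in \<open>auto intro!: polyfun_deg_sum\<close>)
    also have "\<dots> = (\<Sum>k\<le>m. \<Sum>j\<le>k. gamma_op (?F k j) y)"
      by (intro sum.cong refl gamma_op_sum) (use F in auto)
    also have "\<dots> = (\<Sum>k\<le>m. \<Sum>j\<le>k. coeff_C n l j k *
            ((coeff_A n l j k * ((norm y)\<^sup>2) ^ (j - 1) + denom n l j k * ((norm y)\<^sup>2) ^ j) * Q k y
              + (((norm y)\<^sup>2) ^ j + ((norm y)\<^sup>2) ^ Suc j) * Q (Suc k) y))"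
    proof (intro sum.cong refl)
      fix k j assume "k \<in> {..m}"
      then have "2 * k \<le> l" using le[of k] by simp
      from gamma_op_norm_power_mult[OF Q this, of j y, folded n_def]
      show "gamma_op (?F k j) y = coeff_C n l j k *
            ((coeff_A n l j k * ((norm y)\<^sup>2) ^ (j - 1) + denom n l j k * ((norm y)\<^sup>2) ^ j) * Q k y
              + (((norm y)\<^sup>2) ^ j + ((norm y)\<^sup>2) ^ Suc j) * Q (Suc k) y)"
        unfolding gamma_op_cmult[OF T] by (simp add: Q_Suc)
    qed
    also have "\<dots> = Q 0 y + (\<Sum>j\<le>m. coeff_C n l j m * (((norm y)\<^sup>2) ^ j + ((norm y)\<^sup>2) ^ Suc j))
        * Q (Suc m) y"
      by (rule recursion_telescope) (rule nz)
    \<comment> \<open>The remainder carries the iterate \<open>Suc m = h\<close> of the Laplacian,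
      which vanishes by assumption.\<close>
    also have "\<dots> = P y"
      using Qh[of y] by (simp add: m Q_def)
    finally show ?thesis .
  qed
  then have eqn: "(1 + (norm y)\<^sup>2) * laplacian (rpoly_fun g) y
      - 2 * real n * (y \<bullet> gradient (rpoly_fun g) y) + 2 * real n * rpoly_fun g y = P y" for y
    unfolding g by (simp add: gamma_op_def n_def)
  have low: "Poly_Mapping.lookup g u = 0" if "mdeg u < 2" for u
    using keys that by (force simp: in_keys_iff)
  have "rpoly_fun g = (\<lambda>y. \<Sum>k = 0..h - 1. \<Sum>j = 0..k.
        coeff_C n l j k * ((norm y)\<^sup>2) ^ j * (laplacian ^^ k) P y)"
    unfolding g by (simp add: m Q_def atLeast0AtMost mult.assoc)
  moreover have "Poly_Mapping.lookup g 0 = 0"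
    by (rule low) (simp add: mdeg_def)
  moreover have "Poly_Mapping.lookup g (Poly_Mapping.single i 1) = 0" for i
    using mdeg_add_single[of 0 i] by (intro low) (simp add: mdeg_def)
  ultimately show ?thesis
    using eqn keys by (intro exI[of _ g]) auto
qed

end
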